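(* For $\alpha,\beta\in\mathscr{PO}_\infty(\mathbb{N}^2_\leqslant)$ put $\alpha\preccurlyeq\beta$ if and only if $\alpha=\beta\varepsilon$ for some idempotent $\varepsilon\in E(\mathscr{PO}_\infty(\mathbb{N}^2_\leqslant))$. Then the relation $\preccurlyeq$ is the natural partial order on the semigroup $\mathscr{PO}_\infty(\mathbb{N}^2_\leqslant)$.
   Context: $\mathbb{N}$ is the set of positive integers with its usual order, and $\mathbb{N}^2_\leqslant$ is $\mathbb{N}\times\mathbb{N}$ with the product order: $(i,m)\leqslant(j,n)$ iff $i\le j$ and $m\le n$. Partial maps are written on the right and composed left to right: $x(\alpha\beta)=(x\alpha)\beta$, with $\operatorname{dom}(\alpha\beta)=\{y\in\operatorname{dom}\alpha : y\alpha\in\operatorname{dom}\beta\}$. A partial map $\alpha\colon X\rightharpoonup X$ of a poset is monotone if $x\leqslant y$ implies $(x)\alpha\leqslant(y)\alpha$ for all $x,y\in\operatorname{dom}\alpha$. $\mathscr{PO}_\infty(\mathbb{N}^2_\leqslant)$ is the monoid, under composition, of all injective monotone partial selfmaps $\alpha$ of $\mathbb{N}^2_\leqslant$ such that $\operatorname{dom}\alpha$ and $\operatorname{ran}\alpha$ have finite complement in $\mathbb{N}\times\mathbb{N}$. $E(S)$ denotes the set of idempotents of a semigroup $S$. The natural partial order (in the sense of Mitsch) on an arbitrary semigroup $S$ is the relation: $a$ is below $b$ iff there are $x,y\in S^1$ with $a=xb=by$ and $xa=ay=a$; equivalently, iff there are $w,z\in S^1$ with $a=wb=bz$ and $az=a$.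 Here $S^1$ is $S$ with an identity adjoined if $S$ has none. *)

theory Defs
  imports "HOL-Library.Product_Order" "HOL-Algebra.Group"
begin

text \<open>
  Semigroups are given by the \<open>carrier\<close> and \<open>mult\<close> fields of a monoid record; the definitions
  for general semigroups below do not look at the field \<open>one\<close>.
\<close>

definition idempotents :: "('a, 'b) monoid_scheme \<Rightarrow> 'a set" where
  "idempotents S = {e \<in> carrier S. e \<otimes>\<^bsub>S\<^esub> e = e}"

definition has_identity :: "('a, 'b) monoid_scheme \<Rightarrow> bool" where
  "has_identity S \<longleftrightarrow> (\<exists>e \<in> carrier S. \<forall>x \<in> carrier S. e \<otimes>\<^bsub>S\<^esub> x = x \<and> x \<otimes>\<^bsub>S\<^esub> e = x)"

text \<open>
  The semigroup \<open>S\<^sup>1\<close>, realised on the option type: \<open>Some x\<close> is the element \<open>x\<close> of \<open>S\<close>, and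
  \<open>None\<close> is the new identity, which belongs to the carrier only if \<open>S\<close> has no identity.
\<close>

definition carrier1 :: "('a, 'b) monoid_scheme \<Rightarrow> 'a option set" where
  "carrier1 S = (if has_identity S then Some ` carrier S else insert None (Some ` carrier S))"

fun mult1 :: "('a, 'b) monoid_scheme \<Rightarrow> 'a option \<Rightarrow> 'a option \<Rightarrow> 'a option" where
  "mult1 S None v = v"
| "mult1 S u None = u"
| "mult1 S (Some x) (Some y) = Some (x \<otimes>\<^bsub>S\<^esub> y)"

text \<open>Mitsch's natural partial order; \<open>(a, b)\<close> in the relation means that \<open>a\<close> is below \<open>b\<close>.\<close>

definition natural_partial_order :: "('a, 'b) monoid_scheme \<Rightarrow> ('a \<times> 'a) set" where
  "natural_partial_order S =
    {(a, b). a \<in> carrier S \<and> b \<in> carrier S \<and>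
      (\<exists>x \<in> carrier1 S. \<exists>y \<in> carrier1 S.
        Some a = mult1 S x (Some b) \<and> Some a = mult1 S (Some b) y \<and>
        mult1 S x (Some a) = Some a \<and> mult1 S (Some a) y = Some a)}"

text \<open>
  Here \<open>0\<close> is not a natural number. The order on pairs is the componentwise one of
  \<^theory>\<open>HOL-Library.Product_Order\<close>.
\<close>

definition N2 :: "(nat \<times> nat) set" where
  "N2 = {1..} \<times> {1..}"

text \<open>
  Partial maps act on the right, so the product \<open>\<alpha>\<beta>\<close> (first \<open>\<alpha>\<close>, then \<open>\<beta>\<close>) is \<open>\<beta> \<circ>\<^sub>m \<alpha>\<close>.
\<close>

definition PO_inf :: "(nat \<times> nat \<rightharpoonup> nat \<times> nat) monoid" where
  "PO_inf =
    \<lparr>carrier = {\<alpha>. dom \<alpha> \<subseteq> N2 \<and> ran \<alpha> \<subseteq> N2 \<and>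
        inj_on \<alpha> (dom \<alpha>) \<and> mono_on (dom \<alpha>) (\<lambda>x. the (\<alpha> x)) \<and>
        finite (N2 - dom \<alpha>) \<and> finite (N2 - ran \<alpha>)},
     mult = (\<lambda>\<alpha> \<beta>. \<beta> \<circ>\<^sub>m \<alpha>),
     one = (\<lambda>x. if x \<in> N2 then Some x else None)\<rparr>"

lemma PO_inf_mult_closed:
  assumes a: "\<alpha> \<in> carrier PO_inf" and b: "\<beta> \<in> carrier PO_inf"
  shows "\<beta> \<circ>\<^sub>m \<alpha> \<in> carrier PO_inf"
proof -
  have ia: "\<And>x y z. \<alpha> x = Some z \<Longrightarrow> \<alpha> y = Some z \<Longrightarrow> x = y"
  proof -
    fix x y z assume "\<alpha> x = Some z" "\<alpha> y = Some z"
    moreover have "inj_on \<alpha> (dom \<alpha>)" using a by (simp add: PO_inf_def)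
    ultimately show "x = y" by (metis domI inj_onD)
  qed
  have ib: "\<And>x y z. \<beta> x = Some z \<Longrightarrow> \<beta> y = Some z \<Longrightarrow> x = y"
  proof -
    fix x y z assume "\<beta> x = Some z" "\<beta> y = Some z"
    moreover have "inj_on \<beta> (dom \<beta>)" using b by (simp add: PO_inf_def)
    ultimately show "x = y" by (metis domI inj_onD)
  qed
  have ma: "\<And>x y u v. \<alpha> x = Some u \<Longrightarrow> \<alpha> y = Some v \<Longrightarrow> x \<le> y \<Longrightarrow> u \<le> v"
  proof -
    fix x y u v assume *: "\<alpha> x = Some u" "\<alpha> y = Some v" "x \<le> y"
    have "mono_on (dom \<alpha>) (\<lambda>x. the (\<alpha> x))" using a by (simp add: PO_inf_def)
    from monotone_onD[OF this _ _ *(3)] * show "u \<le> v" by (simp add: domIff)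
  qed
  have mb: "\<And>x y u v. \<beta> x = Some u \<Longrightarrow> \<beta> y = Some v \<Longrightarrow> x \<le> y \<Longrightarrow> u \<le> v"
  proof -
    fix x y u v assume *: "\<beta> x = Some u" "\<beta> y = Some v" "x \<le> y"
    have "mono_on (dom \<beta>) (\<lambda>x. the (\<beta> x))" using b by (simp add: PO_inf_def)
    from monotone_onD[OF this _ _ *(3)] * show "u \<le> v" by (simp add: domIff)
  qed
  have fin: "finite (N2 - dom \<alpha>)" "finite (N2 - ran \<alpha>)" "finite (N2 - dom \<beta>)" "finite (N2 - ran \<beta>)"
    using a b by (auto simp: PO_inf_def)
  have sub: "dom \<alpha> \<subseteq> N2" "ran \<alpha> \<subseteq> N2" "dom \<beta> \<subseteq> N2" "ran \<beta> \<subseteq> N2"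
    using a b by (auto simp: PO_inf_def)
  have "inj_on \<alpha> (dom \<alpha>)" using a by (simp add: PO_inf_def)
  then have "finite (\<alpha> -` (Some ` (N2 - dom \<beta>)) \<inter> dom \<alpha>)"
    using fin(3) by (intro finite_vimage_IntI) auto
  moreover have "N2 - dom (\<beta> \<circ>\<^sub>m \<alpha>) \<subseteq> (N2 - dom \<alpha>) \<union> (\<alpha> -` (Some ` (N2 - dom \<beta>)) \<inter> dom \<alpha>)"
  proof
    fix x assume x: "x \<in> N2 - dom (\<beta> \<circ>\<^sub>m \<alpha>)"
    show "x \<in> (N2 - dom \<alpha>) \<union> (\<alpha> -` (Some ` (N2 - dom \<beta>)) \<inter> dom \<alpha>)"
    proof (cases "\<alpha> x")
      case (Some u)
      then have "u \<in> N2" using sub(2) by (auto intro: ranI)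
      moreover have "\<beta> u = None" using x Some by (cases "\<beta> u") (auto simp: dom_def)
      ultimately show ?thesis using Some by (simp add: domIff)
    qed (use x in \<open>simp add: domIff\<close>)
  qed
  ultimately have fd: "finite (N2 - dom (\<beta> \<circ>\<^sub>m \<alpha>))"
    using fin(1) by (meson finite_UnI finite_subset)
  have "N2 - ran (\<beta> \<circ>\<^sub>m \<alpha>) \<subseteq> (N2 - ran \<beta>) \<union> (\<lambda>x. the (\<beta> x)) ` (N2 - ran \<alpha>)"
  proof
    fix z assume z: "z \<in> N2 - ran (\<beta> \<circ>\<^sub>m \<alpha>)"
    show "z \<in> (N2 - ran \<beta>) \<union> (\<lambda>x. the (\<beta> x)) ` (N2 - ran \<alpha>)"
    proof (cases "z \<in> ran \<beta>")
      case True
      then obtain y where y: "\<beta> y = Some z" by (auto simp: ran_def)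
      have "y \<notin> ran \<alpha>"
      proof
        assume "y \<in> ran \<alpha>"
        then obtain x where "\<alpha> x = Some y" by (auto simp: ran_def)
        with y have "(\<beta> \<circ>\<^sub>m \<alpha>) x = Some z" by simp
        with z show False by (auto intro: ranI)
      qed
      moreover have "y \<in> N2" using y sub(3) by auto
      moreover have "z = the (\<beta> y)" using y by simp
      ultimately show ?thesis by blast
    qed (use z in blast)
  qed
  then have fr: "finite (N2 - ran (\<beta> \<circ>\<^sub>m \<alpha>))"
    using fin(2,4) by (meson finite_UnI finite_imageI finite_subset)
  have "dom (\<beta> \<circ>\<^sub>m \<alpha>) \<subseteq> N2" "ran (\<beta> \<circ>\<^sub>m \<alpha>) \<subseteq> N2"
  proof -
    have "dom (\<beta> \<circ>\<^sub>m \<alpha>) \<subseteq> dom \<alpha>" "ran (\<beta> \<circ>\<^sub>m \<alpha>) \<subseteq> ran \<beta>"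
      unfolding dom_def ran_def by (auto simp: map_comp_Some_iff)
    with sub show "dom (\<beta> \<circ>\<^sub>m \<alpha>) \<subseteq> N2" "ran (\<beta> \<circ>\<^sub>m \<alpha>) \<subseteq> N2" by blast+
  qed
  moreover have "inj_on (\<beta> \<circ>\<^sub>m \<alpha>) (dom (\<beta> \<circ>\<^sub>m \<alpha>))"
  proof (rule inj_onI)
    fix x y assume xy: "x \<in> dom (\<beta> \<circ>\<^sub>m \<alpha>)" "(\<beta> \<circ>\<^sub>m \<alpha>) x = (\<beta> \<circ>\<^sub>m \<alpha>) y"
    then obtain z where z: "(\<beta> \<circ>\<^sub>m \<alpha>) x = Some z" "(\<beta> \<circ>\<^sub>m \<alpha>) y = Some z" by (metis domD)
    then obtain u v where "\<alpha> x = Some u" "\<beta> u = Some z" "\<alpha> y = Some v" "\<beta> v = Some z"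
      by (auto simp: map_comp_Some_iff)
    then show "x = y" using ia ib by blast
  qed
  moreover have "mono_on (dom (\<beta> \<circ>\<^sub>m \<alpha>)) (\<lambda>x. the ((\<beta> \<circ>\<^sub>m \<alpha>) x))"
  proof (rule monotone_onI)
    fix x y assume xy: "x \<in> dom (\<beta> \<circ>\<^sub>m \<alpha>)" "y \<in> dom (\<beta> \<circ>\<^sub>m \<alpha>)" "x \<le> y"
    then obtain s t where st: "(\<beta> \<circ>\<^sub>m \<alpha>) x = Some s" "(\<beta> \<circ>\<^sub>m \<alpha>) y = Some t" by (metis domD)
    then obtain u v where "\<alpha> x = Some u" "\<beta> u = Some s" "\<alpha> y = Some v" "\<beta> v = Some t"
      by (auto simp: map_comp_Some_iff)
    then have "s \<le> t" using ma mb xy(3) by blast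
    with st show "the ((\<beta> \<circ>\<^sub>m \<alpha>) x) \<le> the ((\<beta> \<circ>\<^sub>m \<alpha>) y)" by simp
  qed
  ultimately show ?thesis using fd fr by (simp add: PO_inf_def)
qed

lemma monoid_PO_inf: "monoid PO_inf"
proof (rule monoidI)
  fix \<alpha> \<beta> \<gamma>
  show "\<alpha> \<otimes>\<^bsub>PO_inf\<^esub> \<beta> \<in> carrier PO_inf" if "\<alpha> \<in> carrier PO_inf" "\<beta> \<in> carrier PO_inf"
    using PO_inf_mult_closed[OF that] by (simp add: PO_inf_def)
  have "dom (\<one>\<^bsub>PO_inf\<^esub>) = N2" "ran (\<one>\<^bsub>PO_inf\<^esub>) = N2"
    by (auto simp: PO_inf_def dom_def ran_def split: if_splits)
  moreover have "inj_on (\<one>\<^bsub>PO_inf\<^esub>) N2" "mono_on N2 (\<lambda>x. the (\<one>\<^bsub>PO_inf\<^esub> x))"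
    by (auto simp: PO_inf_def inj_on_def monotone_on_def)
  ultimately show "\<one>\<^bsub>PO_inf\<^esub> \<in> carrier PO_inf"
    by (simp add: PO_inf_def)
  show "\<alpha> \<otimes>\<^bsub>PO_inf\<^esub> \<beta> \<otimes>\<^bsub>PO_inf\<^esub> \<gamma> = \<alpha> \<otimes>\<^bsub>PO_inf\<^esub> (\<beta> \<otimes>\<^bsub>PO_inf\<^esub> \<gamma>)"
    by (auto simp: PO_inf_def map_comp_def split: option.splits)
  assume a: "\<alpha> \<in> carrier PO_inf"
  then have *: "\<And>x y. \<alpha> x = Some y \<Longrightarrow> x \<in> N2 \<and> y \<in> N2"
    by (auto simp: PO_inf_def ran_def)
  show "\<one>\<^bsub>PO_inf\<^esub> \<otimes>\<^bsub>PO_inf\<^esub> \<alpha> = \<alpha>"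
  proof
    fix x show "(\<one>\<^bsub>PO_inf\<^esub> \<otimes>\<^bsub>PO_inf\<^esub> \<alpha>) x = \<alpha> x"
      using * by (cases "\<alpha> x") (auto simp: PO_inf_def map_comp_def)
  qed
  show "\<alpha> \<otimes>\<^bsub>PO_inf\<^esub> \<one>\<^bsub>PO_inf\<^esub> = \<alpha>"
  proof
    fix x show "(\<alpha> \<otimes>\<^bsub>PO_inf\<^esub> \<one>\<^bsub>PO_inf\<^esub>) x = \<alpha> x"
      using * by (cases "\<alpha> x") (auto simp: PO_inf_def map_comp_def)
  qed
qed

end

theory Submission
  imports Defs
begin

text \<open>
  The argument rests on injectivity. An injective idempotent must fix every point where it is
  defined, so the idempotents are exactly the identity maps of cofinite subsets of \<open>N2\<close>
  (\<open>idempotents_PO_inf\<close>). Hence \<open>\<alpha> = \<beta>\<epsilon>\<close> says that \<open>\<alpha>\<close> is a restriction of \<open>\<beta>\<close> to those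
  points whose image lies in some set.

  Such a restriction on the range side is also one on the domain side: \<open>\<alpha>\<close> is the identity
  of \<open>dom \<alpha>\<close> followed by \<open>\<beta>\<close>. The two identity maps witness that \<open>\<alpha>\<close> is below \<open>\<beta>\<close>
  in the sense of Mitsch.

  Conversely, if \<open>\<alpha>\<close> is below \<open>\<beta>\<close>, there is \<open>\<eta>\<close> with \<open>\<alpha> = \<beta>\<eta> = \<alpha>\<eta>\<close>. Where \<open>\<alpha>\<close> is defined,
  \<open>\<eta>\<close> sends the values of \<open>\<alpha>\<close> and of \<open>\<beta>\<close> to the same point, so injectivity of \<open>\<eta>\<close> forces these
  values to agree: \<open>\<alpha>\<close> is a restriction of \<open>\<beta>\<close>
  (\<open>map_le_if_common_right_factor\<close>). As \<open>\<beta>\<close> is injective, \<open>\<alpha>\<close> is recovered from \<open>\<beta>\<close> by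
  cutting its values down to \<open>ran \<alpha>\<close>, that is, by composing with an idempotent.
\<close>

definition partial_id :: "'a set \<Rightarrow> 'a \<rightharpoonup> 'a" where
  "partial_id A x = (if x \<in> A then Some x else None)"

lemma dom_partial_id [simp]: "dom (partial_id A) = A"
  by (auto simp: partial_id_def dom_def)

lemma ran_partial_id [simp]: "ran (partial_id A) = A"
  by (auto simp: partial_id_def ran_def)

lemma partial_id_comp_self: "partial_id A \<circ>\<^sub>m partial_id A = partial_id A"
  by (auto simp: partial_id_def map_comp_def)

lemma partial_id_comp_if_ran_subset:
  assumes "ran \<alpha> \<subseteq> A"
  shows "partial_id A \<circ>\<^sub>m \<alpha> = \<alpha>"
proof
  fix x
  show "(partial_id A \<circ>\<^sub>m \<alpha>) x = \<alpha> x"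
    using assms by (cases "\<alpha> x") (auto simp: partial_id_def ran_def)
qed

lemma comp_partial_id_dom:
  assumes "\<alpha> \<subseteq>\<^sub>m \<beta>"
  shows "\<beta> \<circ>\<^sub>m partial_id (dom \<alpha>) = \<alpha>"
proof
  fix x
  show "(\<beta> \<circ>\<^sub>m partial_id (dom \<alpha>)) x = \<alpha> x"
    using assms by (cases "\<alpha> x") (auto simp: partial_id_def map_comp_def map_le_def dom_def)
qed

lemma partial_id_comp_map_le: "partial_id A \<circ>\<^sub>m \<beta> \<subseteq>\<^sub>m \<beta>"
  by (auto simp: map_le_def map_comp_def partial_id_def split: option.splits if_splits)

text \<open>
  An extension of \<open>\<alpha>\<close> takes further values at further points; if it is injective, none of these
  values is in \<open>ran \<alpha>\<close>.
\<close>

lemma partial_id_ran_comp: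
  assumes le: "\<alpha> \<subseteq>\<^sub>m \<beta>" and inj: "inj_on \<beta> (dom \<beta>)"
  shows "partial_id (ran \<alpha>) \<circ>\<^sub>m \<beta> = \<alpha>"
proof
  fix z
  show "(partial_id (ran \<alpha>) \<circ>\<^sub>m \<beta>) z = \<alpha> z"
  proof (cases "\<alpha> z")
    case (Some v)
    then have "\<beta> z = Some v" using le by (metis map_le_def domI)
    with Some show ?thesis by (auto simp: partial_id_def intro: ranI)
  next
    case None
    have "v \<notin> ran \<alpha>" if "\<beta> z = Some v" for v
    proof
      assume "v \<in> ran \<alpha>"
      then obtain w where w: "\<alpha> w = Some v" by (auto simp: ran_def)
      then have "\<beta> w = Some v" using le by (metis map_le_def domI)
      then have "w = z" using that inj by (metis domI inj_onD)
      with w None show False by simp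
    qed
    then show ?thesis using None by (cases "\<beta> z") (auto simp: partial_id_def)
  qed
qed

text \<open>
  Where \<open>\<alpha>\<close> is defined, both \<open>\<alpha>\<close> and \<open>\<beta>\<close> are followed by a value of \<open>\<eta>\<close>, and it is the same one,
  so it can be cancelled.
\<close>

lemma map_le_if_common_right_factor:
  assumes inj: "inj_on \<eta> (dom \<eta>)"
    and \<beta>: "\<eta> \<circ>\<^sub>m \<beta> = \<alpha>" and \<alpha>: "\<eta> \<circ>\<^sub>m \<alpha> = \<alpha>"
  shows "\<alpha> \<subseteq>\<^sub>m \<beta>"
  unfolding map_le_def
proof
  fix z
  assume "z \<in> dom \<alpha>"
  then obtain v where v: "\<alpha> z = Some v" by auto
  then have "\<eta> v = Some v"
    using fun_cong[OF \<alpha>, of z] by simp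
  moreover from v obtain u where "\<beta> z = Some u" "\<eta> u = Some v"
    using fun_cong[OF \<beta>, of z] by (auto simp: map_comp_Some_iff)
  ultimately show "\<alpha> z = \<beta> z"
    using v inj by (metis domI inj_onD)
qed

lemma injective_idempotent_is_partial_id:
  assumes inj: "inj_on \<epsilon> (dom \<epsilon>)" and idem: "\<epsilon> \<circ>\<^sub>m \<epsilon> = \<epsilon>"
  shows "\<epsilon> = partial_id (dom \<epsilon>)"
proof
  fix x
  show "\<epsilon> x = partial_id (dom \<epsilon>) x"
  proof (cases "\<epsilon> x")
    case (Some u)
    then have "\<epsilon> u = Some u" using fun_cong[OF idem, of x] by simp
    with Some inj have "u = x" by (metis domI inj_onD)
    with Some show ?thesis by (auto simp: partial_id_def)
  qed (simp add: partial_id_def domIff)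
qed

lemma mult_PO_inf [simp]: "\<alpha> \<otimes>\<^bsub>PO_inf\<^esub> \<beta> = \<beta> \<circ>\<^sub>m \<alpha>"
  by (simp add: PO_inf_def)

lemma partial_id_in_PO_inf:
  assumes "A \<subseteq> N2" and "finite (N2 - A)"
  shows "partial_id A \<in> carrier PO_inf"
proof -
  have "inj_on (partial_id A) A" "mono_on A (\<lambda>x. the (partial_id A x))"
    by (auto simp: partial_id_def inj_on_def monotone_on_def)
  with assms show ?thesis by (simp add: PO_inf_def)
qed

lemma idempotents_PO_inf:
  "idempotents PO_inf = {partial_id A |A. A \<subseteq> N2 \<and> finite (N2 - A)}" (is "_ = ?ids")
proof
  show "idempotents PO_inf \<subseteq> ?ids"
  proof
    fix \<epsilon>
    assume "\<epsilon> \<in> idempotents PO_inf"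
    then have \<epsilon>: "\<epsilon> \<in> carrier PO_inf" "\<epsilon> \<circ>\<^sub>m \<epsilon> = \<epsilon>"
      by (simp_all add: idempotents_def)
    then have "\<epsilon> = partial_id (dom \<epsilon>)"
      by (intro injective_idempotent_is_partial_id) (simp_all add: PO_inf_def)
    moreover have "dom \<epsilon> \<subseteq> N2" "finite (N2 - dom \<epsilon>)"
      using \<epsilon>(1) by (simp_all add: PO_inf_def)
    ultimately show "\<epsilon> \<in> ?ids" by blast
  qed
  show "?ids \<subseteq> idempotents PO_inf"
    by (auto simp: idempotents_def partial_id_in_PO_inf partial_id_comp_self)
qed

lemma natural_partial_order_monoid:
  assumes "monoid M"
  shows "(a, b) \<in> natural_partial_order M \<longleftrightarrow>
    a \<in> carrier M \<and> b \<in> carrier M \<and>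
    (\<exists>x \<in> carrier M. \<exists>y \<in> carrier M.
      a = x \<otimes>\<^bsub>M\<^esub> b \<and> a = b \<otimes>\<^bsub>M\<^esub> y \<and> x \<otimes>\<^bsub>M\<^esub> a = a \<and> a \<otimes>\<^bsub>M\<^esub> y = a)"
proof -
  interpret monoid M by fact
  have "has_identity M"
    unfolding has_identity_def by (intro bexI[of _ "\<one>\<^bsub>M\<^esub>"]) auto
  then show ?thesis
    by (simp add: natural_partial_order_def carrier1_def)
qed

theorem proposition3:
  shows "{(\<alpha>, \<beta>). \<alpha> \<in> carrier PO_inf \<and> \<beta> \<in> carrier PO_inf \<and>
            (\<exists>\<epsilon> \<in> idempotents PO_inf. \<alpha> = \<beta> \<otimes>\<^bsub>PO_inf\<^esub> \<epsilon>)}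
         = natural_partial_order PO_inf"
    (is "?R = _")
proof (intro equalityI subrelI)
  fix \<alpha> \<beta>
  assume "(\<alpha>, \<beta>) \<in> ?R"
  then obtain \<epsilon> where \<alpha>: "\<alpha> \<in> carrier PO_inf" "\<alpha> = \<epsilon> \<circ>\<^sub>m \<beta>"
    and \<beta>: "\<beta> \<in> carrier PO_inf" and \<epsilon>: "\<epsilon> \<in> idempotents PO_inf"
    by auto
  from \<epsilon> obtain A where A: "\<epsilon> = partial_id A"
    by (auto simp: idempotents_PO_inf)
  have le: "\<alpha> \<subseteq>\<^sub>m \<beta>"
    unfolding \<alpha>(2) A by (rule partial_id_comp_map_le)
  have "ran \<alpha> \<subseteq> A"
    by (auto simp: \<alpha>(2) A ran_def map_comp_Some_iff partial_id_def split: if_splits)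
  then have "\<epsilon> \<circ>\<^sub>m \<alpha> = \<alpha>"
    unfolding A by (rule partial_id_comp_if_ran_subset)
  moreover have "\<epsilon> \<in> carrier PO_inf"
    using \<epsilon> by (simp add: idempotents_def)
  moreover have "partial_id (dom \<alpha>) \<in> carrier PO_inf"
    using \<alpha>(1) by (intro partial_id_in_PO_inf) (simp_all add: PO_inf_def)
  moreover have "\<beta> \<circ>\<^sub>m partial_id (dom \<alpha>) = \<alpha>" "\<alpha> \<circ>\<^sub>m partial_id (dom \<alpha>) = \<alpha>"
    using le by (simp_all add: comp_partial_id_dom)
  ultimately show "(\<alpha>, \<beta>) \<in> natural_partial_order PO_inf"
    using \<alpha> \<beta> unfolding natural_partial_order_monoid[OF monoid_PO_inf] mult_PO_inf
    by metis
next
  fix \<alpha> \<beta>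
  assume "(\<alpha>, \<beta>) \<in> natural_partial_order PO_inf"
  then obtain \<eta> where carrier: "\<alpha> \<in> carrier PO_inf" "\<beta> \<in> carrier PO_inf" "\<eta> \<in> carrier PO_inf"
    and eqs: "\<eta> \<circ>\<^sub>m \<beta> = \<alpha>" "\<eta> \<circ>\<^sub>m \<alpha> = \<alpha>"
    unfolding natural_partial_order_monoid[OF monoid_PO_inf] mult_PO_inf by metis
  have inj: "inj_on \<beta> (dom \<beta>)" "inj_on \<eta> (dom \<eta>)"
    using carrier by (simp_all add: PO_inf_def)
  have "\<alpha> = \<beta> \<otimes>\<^bsub>PO_inf\<^esub> partial_id (ran \<alpha>)"
    using partial_id_ran_comp[OF map_le_if_common_right_factor[OF inj(2) eqs] inj(1)] by simp
  moreover have "ran \<alpha> \<subseteq> N2" "finite (N2 - ran \<alpha>)"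
    using carrier(1) by (simp_all add: PO_inf_def)
  then have "partial_id (ran \<alpha>) \<in> idempotents PO_inf"
    by (auto simp: idempotents_PO_inf)
  ultimately show "(\<alpha>, \<beta>) \<in> ?R"
    using carrier by blast
qed

end
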